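(* Let $G=(\mathcal M\cup\mathcal W,E)$ be any bipartite graph with finite sets $\mathcal M=\{m_1,\dots,m_M\}$ (men) and $\mathcal W=\{w_1,\dots,w_W\}$ (women) and edge set $E\subseteq\mathcal M\times\mathcal W$. Suppose that each agent (man or woman) ranks his/her neighbours in $G$ in a strict linear order chosen uniformly at random, independently of the other agents, non-neighbours being unacceptable. Then the output distributions of the men-proposing deferred acceptance procedure (MPDA) and of the women-proposing deferred acceptance procedure (WPDA) on this random preference profile are identical; that is, for every matching $\mu\subseteq E$ of $G$, $$\mathbb P[\text{MPDA outputs }\mu]=\mathbb P[\text{WPDA outputs }\mu].$$
   Context: A matching of $G$ is a set $\mu\subseteq E$ of edges such that every agent belongs to at most one edge of $\mu$. An agent belonging to no edge of $\mu$ is unmatched. Every agent prefers any of his/her neighbours in $G$ to being unmatched. A pair $(m,w)\in E\setminus\mu$ blocks $\mu$ if ($m$ is unmatched or $m$ strictly prefers $w$ to his partner in $\mu$) and ($w$ is unmatched or $w$ strictly prefers $m$ to her partner in $\mu$). A matching is stable if no pair blocks it. MPDA is the Gale--Shapley deferred acceptance algorithm in which men propose. Its output is the men-optimal stable matching, i.e. the unique stable matching that every man weakly prefers to every other stable matching. WPDA is the same algorithm with women proposing. Its output is the women-optimal stable matching, i.e. the unique stable matching that every woman weakly prefers to every other stable matching. (It is classical that both exist and that all stable matchings match the same set of agents.) *)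

theory Defs
  imports "HOL-Probability.Probability" "HOL-Library.While_Combinator"
begin

text \<open>
  A bipartite graph is given by its edge set \<open>E :: ('m \<times> 'w) set\<close>, men and women having
  different types. A preference order is a strict linear order as a relation;
  \<open>(a, b) \<in> r\<close> reads ``\<open>a\<close> is strictly preferred to \<open>b\<close>''. Being unmatched needs no
  representation, as it is worse than every neighbour.
\<close>

definition matching :: "('m \<times> 'w) set \<Rightarrow> ('m \<times> 'w) set \<Rightarrow> bool" where
  "matching E \<mu> \<longleftrightarrow> \<mu> \<subseteq> E \<and> single_valued \<mu> \<and> single_valued (converse \<mu>)"

text \<open>The inclusion \<open>r \<subseteq> A \<times> A\<close> is needed because \<open>strict_linear_order_on\<close> does not
  confine \<open>r\<close> to \<open>A\<close>.\<close>

definition pref_orders :: "'a set \<Rightarrow> 'a rel set" where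
  "pref_orders A = {r. r \<subseteq> A \<times> A \<and> strict_linear_order_on A r}"

text \<open>
  Deferred acceptance in rounds, with state the set \<open>R\<close> of edges along which a proposal has
  been rejected so far. In each round every man with a neighbour that has not rejected him
  proposes to the best such neighbour (a tentatively held man thereby repeats his proposal),
  and every woman rejects all but the best of her proposals. The procedure stops after a round
  without rejections, and the standing proposals form the output.
\<close>

definition proposals ::
  "('m \<times> 'w) set \<Rightarrow> ('m \<Rightarrow> 'w rel) \<Rightarrow> ('m \<times> 'w) set \<Rightarrow> ('m \<times> 'w) set" where
  "proposals E P R =
     {(m, w). (m, w) \<in> E - R \<and> (\<forall>w'. (m, w') \<in> E - R \<and> w' \<noteq> w \<longrightarrow> (w, w') \<in> P m)}"

definition rejections ::
  "('m \<times> 'w) set \<Rightarrow> ('m \<Rightarrow> 'w rel) \<Rightarrow> ('w \<Rightarrow> 'm rel) \<Rightarrow> ('m \<times> 'w) set \<Rightarrow> ('m \<times> 'w) set" where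
  "rejections E P Q R =
     {(m, w). (m, w) \<in> proposals E P R \<and> (\<exists>m'. (m', w) \<in> proposals E P R \<and> (m', m) \<in> Q w)}"

definition mpda ::
  "('m \<times> 'w) set \<Rightarrow> ('m \<Rightarrow> 'w rel) \<Rightarrow> ('w \<Rightarrow> 'm rel) \<Rightarrow> ('m \<times> 'w) set" where
  "mpda E P Q =
     proposals E P (while (\<lambda>R. rejections E P Q R \<noteq> {}) (\<lambda>R. R \<union> rejections E P Q R) {})"

definition wpda ::
  "('m \<times> 'w) set \<Rightarrow> ('m \<Rightarrow> 'w rel) \<Rightarrow> ('w \<Rightarrow> 'm rel) \<Rightarrow> ('m \<times> 'w) set" where
  "wpda E P Q = converse (mpda (converse E) Q P)"

text \<open>\<open>Pi_pmf\<close> is the product distribution; its second argument \<open>{}\<close> is only the value taken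
  at arguments that are not agents.\<close>

definition random_profile ::
  "'m set \<Rightarrow> 'w set \<Rightarrow> ('m \<times> 'w) set \<Rightarrow> (('m \<Rightarrow> 'w rel) \<times> ('w \<Rightarrow> 'm rel)) pmf" where
  "random_profile M W E =
     pair_pmf (Pi_pmf M {} (\<lambda>m. pmf_of_set (pref_orders (E `` {m}))))
              (Pi_pmf W {} (\<lambda>w. pmf_of_set (pref_orders (converse E `` {w}))))"

end

theory Submission
  imports Defs
begin

text \<open>
  Fix a matching \<open>\<mu>\<close>. It is the men-optimal stable matching iff it is stable and the graph in which
  each woman points to her favourite among the men desiring her exposes no rotation. Call a set \<open>B\<close>
  of edges alternating if it consists of disjoint cycles alternating with \<open>\<mu>\<close>. Exchanging, in the
  ranking of every woman in \<open>B\<close>, her \<open>\<mu>\<close>-partner with her \<open>B\<close>-partner is an involution on profiles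
  that turns ``\<open>\<mu>\<close> is stable and the pointers contain \<open>B\<close>'' into ``the pairs blocking \<open>\<mu>\<close> are exactly
  those in \<open>B\<close>''. The latter condition is symmetric in men and women, so for every \<open>B\<close> equally many
  stable profiles have \<open>B\<close> among the cycles of the women's pointers as among those of the men's
  pointers. Moebius inversion over the inclusion order of the sets \<open>B\<close> gives equally many stable
  profiles without cycles, that is, equally many with MPDA output \<open>\<mu>\<close> as with WPDA output \<open>\<mu>\<close>.
\<close>

section \<open>Preference orders\<close>

lemma pref_orders_irrefl: "r \<in> pref_orders A \<Longrightarrow> (a, a) \<notin> r"
  by (auto simp: pref_orders_def strict_linear_order_on_def irrefl_def)

lemma pref_orders_trans: "r \<in> pref_orders A \<Longrightarrow> (a, b) \<in> r \<Longrightarrow> (b, c) \<in> r \<Longrightarrow> (a, c) \<in> r"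
  by (auto simp: pref_orders_def strict_linear_order_on_def dest: transD)

lemma pref_orders_asym: "r \<in> pref_orders A \<Longrightarrow> (a, b) \<in> r \<Longrightarrow> (b, a) \<notin> r"
  by (blast dest: pref_orders_trans pref_orders_irrefl)

lemma pref_orders_total:
  "r \<in> pref_orders A \<Longrightarrow> a \<in> A \<Longrightarrow> b \<in> A \<Longrightarrow> a \<noteq> b \<Longrightarrow> (a, b) \<in> r \<or> (b, a) \<in> r"
  by (auto simp: pref_orders_def strict_linear_order_on_def total_on_def)

lemma pref_orders_best:
  assumes r: "r \<in> pref_orders A" and "finite S" "S \<noteq> {}" "S \<subseteq> A"
  shows "\<exists>x\<in>S. \<forall>y\<in>S. y \<noteq> x \<longrightarrow> (x, y) \<in> r"
  using assms(2-4)
proof (induction S rule: finite_ne_induct)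
  case (singleton x)
  then show ?case by simp
next
  case (insert x F)
  then obtain b where b: "b \<in> F" "\<forall>y\<in>F. y \<noteq> b \<longrightarrow> (b, y) \<in> r" by auto
  have "b \<noteq> x" "b \<in> A" "x \<in> A" using insert b by auto
  then consider "(b, x) \<in> r" | "(x, b) \<in> r" using pref_orders_total[OF r] by blast
  then show ?case
  proof cases
    case 1
    then show ?thesis using b by blast
  next
    case 2
    then have "\<forall>y\<in>F. (x, y) \<in> r" using b pref_orders_trans[OF r, of x b] by metis
    then show ?thesis by blast
  qed
qed

lemma finite_pref_orders: "finite A \<Longrightarrow> finite (pref_orders A)"
  by (rule finite_subset[of _ "Pow (A \<times> A)"]) (auto simp: pref_orders_def)

lemma pref_orders_nonempty:
  assumes "finite A"
  shows "pref_orders A \<noteq> {}"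
proof -
  obtain f :: "'a \<Rightarrow> nat" where f: "inj_on f A" using finite_imp_inj_to_nat_seg[OF assms] by blast
  have "{(a, b). a \<in> A \<and> b \<in> A \<and> f a < f b} \<in> pref_orders A"
    using f by (auto simp: pref_orders_def strict_linear_order_on_def trans_def irrefl_def
        total_on_def inj_on_def) (metis linorder_neqE_nat)
  then show ?thesis by blast
qed

text \<open>An involution mapping \<open>A\<close> into itself also keeps the complement of
  \<open>A\<close> invariant, so pulling back along it merely relabels the members of
  \<open>A\<close>.\<close>

lemma pref_orders_inv_image:
  assumes r: "r \<in> pref_orders A" and t: "\<And>a. t (t a) = a" "\<And>a. a \<in> A \<Longrightarrow> t a \<in> A"
  shows "inv_image r t \<in> pref_orders A"
proof -
  have inj: "t a = t b \<Longrightarrow> a = b" for a b using t(1) by metis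
  have sub: "a \<in> A" if "t a \<in> A" for a using t that by metis
  have "inv_image r t \<subseteq> A \<times> A"
    using r sub by (auto simp: pref_orders_def inv_image_def)
  moreover have "total_on A (inv_image r t)"
    unfolding total_on_def in_inv_image using pref_orders_total[OF r] t(2) inj by metis
  moreover have "trans (inv_image r t)"
    using r by (auto simp: pref_orders_def strict_linear_order_on_def intro: trans_inv_image)
  moreover have "irrefl (inv_image r t)"
    using pref_orders_irrefl[OF r] by (auto simp: irrefl_def inv_image_def)
  ultimately show ?thesis by (simp add: pref_orders_def strict_linear_order_on_def)
qed

section \<open>Stable matchings and rotations\<close>

text \<open>The quantifier is vacuous for a man unmatched in \<mu>, so he desires all his
  neighbours. The desires of women are given by the same definition on the converse graph.\<close>

definition envy :: "('m \<times> 'w) set \<Rightarrow> ('m \<Rightarrow> 'w rel) \<Rightarrow> ('m \<times> 'w) set \<Rightarrow> ('m \<times> 'w) set" where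
  "envy E P \<mu> = {(m, w). (m, w) \<in> E \<and> (\<forall>w'. (m, w') \<in> \<mu> \<longrightarrow> (w, w') \<in> P m)}"

definition blocking ::
  "('m \<times> 'w) set \<Rightarrow> ('m \<Rightarrow> 'w rel) \<Rightarrow> ('w \<Rightarrow> 'm rel) \<Rightarrow> ('m \<times> 'w) set \<Rightarrow> ('m \<times> 'w) set" where
  "blocking E P Q \<mu> = envy E P \<mu> \<inter> converse (envy (converse E) Q (converse \<mu>))"

definition stable_matching ::
  "('m \<times> 'w) set \<Rightarrow> ('m \<Rightarrow> 'w rel) \<Rightarrow> ('w \<Rightarrow> 'm rel) \<Rightarrow> ('m \<times> 'w) set \<Rightarrow> bool" where
  "stable_matching E P Q \<mu> \<longleftrightarrow> matching E \<mu> \<and> blocking E P Q \<mu> = {}"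

text \<open>Every woman points to her favourite among the men who would leave their partner for her.
  Cycles of \<open>w \<mapsto> m \<mapsto> \<mu>(m)\<close> along these pointers are the rotations exposed in \<open>\<mu>\<close>, with the men
  improving.\<close>

definition pointing ::
  "('m \<times> 'w) set \<Rightarrow> ('m \<Rightarrow> 'w rel) \<Rightarrow> ('w \<Rightarrow> 'm rel) \<Rightarrow> ('m \<times> 'w) set \<Rightarrow> ('m \<times> 'w) set" where
  "pointing E P Q \<mu> = {(m, w). (m, w) \<in> envy E P \<mu> \<and>
     (\<forall>m'. (m', w) \<in> envy E P \<mu> \<and> m' \<noteq> m \<longrightarrow> (m, m') \<in> Q w)}"

text \<open>A disjoint union of cycles alternating between \<open>B\<close> and \<open>\<mu>\<close>, recorded by its
  \<open>B\<close>-edges.\<close>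

definition alternating :: "('m \<times> 'w) set \<Rightarrow> ('m \<times> 'w) set \<Rightarrow> bool" where
  "alternating \<mu> B \<longleftrightarrow> single_valued B \<and> single_valued (converse B) \<and>
     \<mu> `` Domain B = Range B \<and> converse \<mu> `` Range B = Domain B"

lemma alternating_empty: "alternating \<mu> {}"
  by (simp add: alternating_def)

lemma alternating_converse: "alternating (converse \<mu>) (converse B) \<longleftrightarrow> alternating \<mu> B"
  by (auto simp: alternating_def)

lemma matching_converse: "matching (converse E) (converse \<mu>) \<longleftrightarrow> matching E \<mu>"
  by (auto simp: matching_def)

lemma blocking_converse: "blocking (converse E) Q P (converse \<mu>) = converse (blocking E P Q \<mu>)"
  by (auto simp: blocking_def)

lemma stable_converse: "stable_matching (converse E) Q P (converse \<mu>) \<longleftrightarrow> stable_matching E P Q \<mu>"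
  by (auto simp: stable_matching_def matching_converse blocking_converse)

text \<open>The iterated images of \<open>S\<close> shrink until they are stable. A map of a finite
  set onto itself is a permutation, so \<open>T\<close> is a union of cycles of
  \<open>f\<close>.\<close>

lemma image_eq_subset_exists:
  assumes "finite S" "S \<noteq> {}" "f ` S \<subseteq> S"
  shows "\<exists>T\<subseteq>S. T \<noteq> {} \<and> f ` T = T"
  using assms
proof (induction S rule: finite_psubset_induct)
  case (psubset S)
  show ?case
  proof (cases "f ` S = S")
    case True
    then show ?thesis using psubset.prems by blast
  next
    case False
    then have "f ` S \<subset> S" "f ` S \<noteq> {}" "f ` f ` S \<subseteq> f ` S" using psubset.prems by auto
    then obtain T where "T \<subseteq> f ` S" "T \<noteq> {}" "f ` T = T"
      using psubset.IH[of "f ` S"] by metis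
    then show ?thesis using psubset.prems(2) by (meson order_trans)
  qed
qed

text \<open>The assumptions are symmetric in the two sides, so facts about men carry over to women
  by interpreting the locale with \<open>converse E\<close>, \<open>Q\<close> and
  \<open>P\<close>.\<close>

locale market =
  fixes E :: "('m \<times> 'w) set" and P :: "'m \<Rightarrow> 'w rel" and Q :: "'w \<Rightarrow> 'm rel"
  assumes fin: "finite E"
    and P: "\<And>m. P m \<in> pref_orders (E `` {m})"
    and Q: "\<And>w. Q w \<in> pref_orders (converse E `` {w})"
begin

lemmas P_irrefl = pref_orders_irrefl[OF P] and P_trans = pref_orders_trans[OF P]
  and P_asym = pref_orders_asym[OF P]
lemmas Q_irrefl = pref_orders_irrefl[OF Q] and Q_trans = pref_orders_trans[OF Q]
  and Q_asym = pref_orders_asym[OF Q]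

lemma P_total: "(m, w) \<in> E \<Longrightarrow> (m, w') \<in> E \<Longrightarrow> w \<noteq> w' \<Longrightarrow> (w, w') \<in> P m \<or> (w', w) \<in> P m"
  using pref_orders_total[OF P] by blast

lemma Q_total: "(m, w) \<in> E \<Longrightarrow> (m', w) \<in> E \<Longrightarrow> m \<noteq> m' \<Longrightarrow> (m, m') \<in> Q w \<or> (m', m) \<in> Q w"
  using pref_orders_total[OF Q] by blast

lemma P_best:
  assumes "R \<subseteq> E" "(m, w) \<in> R"
  shows "\<exists>w0. (m, w0) \<in> R \<and> (\<forall>w'. (m, w') \<in> R \<and> w' \<noteq> w0 \<longrightarrow> (w0, w') \<in> P m)"
proof -
  have "finite R" using assms(1) fin finite_subset by blast
  then have "finite (R `` {m})" by simp
  then show ?thesis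
    using pref_orders_best[OF P[of m], of "R `` {m}"] assms by blast
qed

lemma Q_best:
  assumes "R \<subseteq> E" "(m, w) \<in> R"
  shows "\<exists>m0. (m0, w) \<in> R \<and> (\<forall>m'. (m', w) \<in> R \<and> m' \<noteq> m0 \<longrightarrow> (m0, m') \<in> Q w)"
proof -
  have "finite (converse R)" using assms(1) fin finite_subset by blast
  then have "finite (converse R `` {w})" using finite_Image by blast
  then show ?thesis
    using pref_orders_best[OF Q[of w], of "converse R `` {w}"] assms by blast
qed

lemma envy_subset: "envy E P \<mu> \<subseteq> E"
  by (auto simp: envy_def)

lemma pointing_subset: "pointing E P Q \<mu> \<subseteq> envy E P \<mu>"
  by (auto simp: pointing_def)

lemma single_valued_pointing: "single_valued (converse (pointing E P Q \<mu>))"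
  unfolding single_valued_def pointing_def using Q_asym by blast

text \<open>As the pair does not block, the woman has a partner she does not rank below
  \<open>m\<close>. This partner is not \<open>m\<close> himself, since nobody envies for his own
  partner, and totality makes the preference strict.\<close>

lemma stableD: "stable_matching E P Q \<mu> \<Longrightarrow> (m, w) \<in> envy E P \<mu> \<Longrightarrow> \<exists>m'. (m', w) \<in> \<mu> \<and> (m', m) \<in> Q w"
proof -
  assume st: "stable_matching E P Q \<mu>" and e: "(m, w) \<in> envy E P \<mu>"
  have E: "(m, w) \<in> E" using e by (simp add: envy_def)
  have "(w, m) \<notin> envy (converse E) Q (converse \<mu>)"
    using st e by (auto simp: stable_matching_def blocking_def)
  then obtain m' where m': "(m', w) \<in> \<mu>" "(m, m') \<notin> Q w" using E by (auto simp: envy_def)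
  moreover have "(m, w) \<notin> \<mu>" using e P_irrefl by (auto simp: envy_def)
  moreover have "(m', w) \<in> E" using m' st by (auto simp: stable_matching_def matching_def)
  ultimately show ?thesis using Q_total[OF E, of m'] by blast
qed

lemma stable_converseD:
  "stable_matching E P Q \<mu> \<Longrightarrow> (w, m) \<in> envy (converse E) Q (converse \<mu>) \<Longrightarrow> \<exists>w'. (m, w') \<in> \<mu> \<and> (w', w) \<in> P m"
proof -
  assume st: "stable_matching E P Q \<mu>" and e: "(w, m) \<in> envy (converse E) Q (converse \<mu>)"
  interpret dual: market "converse E" Q P
    by unfold_locales (use fin P Q in auto)
  show ?thesis using dual.stableD[of "converse \<mu>" w m] st e by (simp add: stable_converse)
qed

text \<open>Men only gain, so a man in a pair blocking the new matching already desired the woman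
  under \<mu>. A woman in \<open>B\<close> now has the best of the men desiring her, and any other
  woman keeps a partner whom stability of \<mu> places above that man.\<close>

lemma rotate_stable:
  assumes st: "stable_matching E P Q \<mu>" and alt: "alternating \<mu> B" and BP: "B \<subseteq> pointing E P Q \<mu>"
  shows "stable_matching E P Q ({(m, w) \<in> \<mu>. m \<notin> Domain B} \<union> B)" (is "stable_matching E P Q ?\<nu>")
proof -
  have mat: "matching E \<mu>" using st by (simp add: stable_matching_def)
  have sv: "single_valued \<mu>" "single_valued (converse \<mu>)" "\<mu> \<subseteq> E"
    using mat by (auto simp: matching_def)
  have svB: "single_valued B" "single_valued (converse B)"
    and im: "\<mu> `` Domain B = Range B" "converse \<mu> `` Range B = Domain B"
    using alt by (auto simp: alternating_def)
  have BA: "B \<subseteq> envy E P \<mu>" using BP pointing_subset by blast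
  \<comment> \<open>Partners in \<mu> are either both rotated or both kept, so no woman receives two
    men.\<close>
  have dom: "m \<in> Domain B \<longleftrightarrow> w \<in> Range B" if "(m, w) \<in> \<mu>" for m w
    using that im by blast
  have "matching E ?\<nu>"
    unfolding matching_def
  proof (intro conjI)
    show "?\<nu> \<subseteq> E" using sv BA envy_subset by blast
    show "single_valued ?\<nu>"
      using sv(1) svB(1) by (auto simp: single_valued_def)
    show "single_valued (converse ?\<nu>)"
      using sv(2) svB(2) dom by (auto simp: single_valued_def)
  qed
  moreover have "blocking E P Q ?\<nu> = {}"
  proof (rule ccontr)
    assume "blocking E P Q ?\<nu> \<noteq> {}"
    then obtain m w where "(m, w) \<in> blocking E P Q ?\<nu>" by auto
    then have mw: "(m, w) \<in> E" "\<And>w'. (m, w') \<in> ?\<nu> \<Longrightarrow> (w, w') \<in> P m"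
      "\<And>m'. (m', w) \<in> ?\<nu> \<Longrightarrow> (m, m') \<in> Q w"
      by (auto simp: blocking_def envy_def)
    have A: "(m, w) \<in> envy E P \<mu>"
    proof -
      have "(w, w') \<in> P m" if w': "(m, w') \<in> \<mu>" for w'
      proof (cases "m \<in> Domain B")
        case True
        then obtain v where v: "(m, v) \<in> B" by blast
        then have "(v, w') \<in> P m" using BA w' by (auto simp: envy_def)
        moreover have "(w, v) \<in> P m" using mw(2) v by blast
        ultimately show ?thesis using P_trans by blast
      next
        case False
        then show ?thesis using mw(2) w' by blast
      qed
      then show ?thesis using mw(1) by (simp add: envy_def)
    qed
    show False
    proof (cases "w \<in> Range B")
      case True
      then obtain p where p: "(p, w) \<in> B" by blast
      then have "(m, p) \<in> Q w" using mw(3) by blast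
      moreover have "m = p \<or> (p, m) \<in> Q w" using p BP A by (auto simp: pointing_def)
      ultimately show False using Q_asym Q_irrefl by blast
    next
      case False
      obtain h where h: "(h, w) \<in> \<mu>" "(h, m) \<in> Q w" using stableD[OF st A] by blast
      then have "(h, w) \<in> ?\<nu>" using dom False by blast
      then show False using mw(3) h Q_asym by blast
    qed
  qed
  ultimately show ?thesis by (simp add: stable_matching_def)
qed

text \<open>The women who lose when \<open>\<mu>\<close> is replaced by \<open>\<nu>\<close> point at men who gain, and those
  are the \<open>\<mu>\<close>-partners of such women; finiteness yields a cycle.\<close>

lemma rotation_exists:
  assumes st: "stable_matching E P Q \<mu>" and st': "stable_matching E P Q \<nu>" and ne: "\<nu> \<inter> envy E P \<mu> \<noteq> {}"
  shows "\<exists>B\<subseteq>pointing E P Q \<mu>. alternating \<mu> B \<and> B \<noteq> {}"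
proof -
  define D where "D = \<nu> \<inter> envy E P \<mu>"
  have sv: "single_valued \<mu>" "single_valued (converse \<mu>)" "\<mu> \<subseteq> E"
    using st by (auto simp: stable_matching_def matching_def)
  have sv': "single_valued \<nu>" "single_valued (converse \<nu>)" "\<nu> \<subseteq> E"
    using st' by (auto simp: stable_matching_def matching_def)
  have finD: "finite D" using fin sv' finite_subset unfolding D_def by blast
  have finR: "finite (Range D)" and finDom: "finite (Domain D)"
    using finD by (auto simp: finite_Range finite_Domain)
  \<comment> \<open>A man \<open>h\<close> whom \<open>w\<close> prefers to her \<nu>-partner must,
    by stability of \<nu>, have a \<nu>-partner better than \<open>w\<close>, hence better than his
    partner in \<mu>.\<close>
  have gain: "h \<in> Domain D" if "(m, w) \<in> D" "(h, m) \<in> Q w" "(h, w) \<in> \<mu> \<or> (h, w) \<in> envy E P \<mu>"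
    for m w h
  proof -
    have hE: "(h, w) \<in> E" using that(3) sv envy_subset by blast
    have mw: "(m, w) \<in> \<nu>" using that by (simp add: D_def)
    have "(h, m') \<in> Q w" if "(m', w) \<in> \<nu>" for m'
      using that mw sv'(2) \<open>(h, m) \<in> Q w\<close> by (auto simp: single_valued_def)
    then have "(w, h) \<in> envy (converse E) Q (converse \<nu>)" using hE by (simp add: envy_def)
    then obtain w' where w': "(h, w') \<in> \<nu>" "(w', w) \<in> P h"
      using stable_converseD[OF st'] by blast
    have "(w', v) \<in> P h" if v: "(h, v) \<in> \<mu>" for v
      using \<open>(h, w) \<in> \<mu> \<or> (h, w) \<in> envy E P \<mu>\<close>
    proof
      assume "(h, w) \<in> \<mu>"
      then show ?thesis using v w' sv(1) by (auto simp: single_valued_def)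
    next
      assume "(h, w) \<in> envy E P \<mu>"
      then have "(w, v) \<in> P h" using v by (simp add: envy_def)
      then show ?thesis using w' P_trans by blast
    qed
    then have "(h, w') \<in> envy E P \<mu>" using w' sv' by (auto simp: envy_def)
    then show ?thesis using w' by (auto simp: D_def)
  qed
  define g where "g = (\<lambda>w. SOME h. (h, w) \<in> \<mu>)"
  have g: "(g w, w) \<in> \<mu>" "g w \<in> Domain D" if w: "w \<in> Range D" for w
  proof -
    obtain m where m: "(m, w) \<in> D" using w by blast
    then obtain h where h: "(h, w) \<in> \<mu>" "(h, m) \<in> Q w"
      using stableD[OF st, of m w] by (auto simp: D_def)
    show gw: "(g w, w) \<in> \<mu>" unfolding g_def using h(1) by (rule someI)
    then have "g w = h" using h sv(2) by (auto simp: single_valued_def)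
    then show "g w \<in> Domain D" using gain[OF m h(2)] h by blast
  qed
  \<comment> \<open>Taking \<mu>-partners injects the losing women into the gaining men, and taking
    \<nu>-partners injects the gaining men into the losing women. The two finite sets thus have the
    same size and \<open>g\<close> is onto.\<close>
  have inj: "inj_on g (Range D)"
    using g(1) sv(1) by (metis inj_onI single_valuedD)
  define k where "k = (\<lambda>m. SOME w. (m, w) \<in> D)"
  have k: "(m, k m) \<in> D" if "m \<in> Domain D" for m
    unfolding k_def using that by (metis Domain_iff someI_ex)
  have "inj_on k (Domain D)"
    by (rule inj_onI) (metis k sv'(2) D_def IntD1 converse_iff single_valuedD)
  moreover have "k ` Domain D \<subseteq> Range D" using k by blast
  ultimately have "card (Domain D) \<le> card (Range D)" using finR by (rule card_inj_on_le)
  moreover have "g ` Range D \<subseteq> Domain D" using g by blast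
  ultimately have gim: "g ` Range D = Domain D"
    using inj finDom by (metis card_image card_seteq)
  define p where "p = (\<lambda>w. SOME m. (m, w) \<in> pointing E P Q \<mu>)"
  have p: "(p w, w) \<in> pointing E P Q \<mu>" "p w \<in> Domain D" if w: "w \<in> Range D" for w
  proof -
    obtain m where m: "(m, w) \<in> D" using w by blast
    then have "(m, w) \<in> envy E P \<mu>" by (simp add: D_def)
    from Q_best[OF envy_subset this] obtain q where
      "(q, w) \<in> pointing E P Q \<mu>" by (auto simp: pointing_def)
    then show pw: "(p w, w) \<in> pointing E P Q \<mu>" unfolding p_def by (rule someI)
    have "m = p w \<or> (p w, m) \<in> Q w" using pw m by (auto simp: pointing_def D_def)
    then show "p w \<in> Domain D" using gain[OF m] m pw pointing_subset by blast
  qed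
  \<comment> \<open>One step along the pointers: from a woman to the man she points at and on to his
    \<mu>-partner. She is again a losing woman because \<open>g\<close> is onto the gaining
    men.\<close>
  define f where "f = (\<lambda>w. SOME v. (p w, v) \<in> \<mu>)"
  have f: "(p w, f w) \<in> \<mu>" "f w \<in> Range D" if w: "w \<in> Range D" for w
  proof -
    obtain v where v: "v \<in> Range D" "p w = g v" using p(2)[OF w] gim by blast
    then have pv: "(p w, v) \<in> \<mu>" using g by simp
    then show *: "(p w, f w) \<in> \<mu>" unfolding f_def by (rule someI)
    have "f w = v" using * pv sv(1) by (auto simp: single_valued_def)
    then show "f w \<in> Range D" using v by simp
  qed
  have "Range D \<noteq> {}" using ne unfolding D_def by auto
  moreover have "f ` Range D \<subseteq> Range D" using f by blast
  ultimately obtain T where T: "T \<subseteq> Range D" "T \<noteq> {}" "f ` T = T"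
    using image_eq_subset_exists[OF finR] by metis
  define B where "B = (\<lambda>w. (p w, w)) ` T"
  have "finite T" using T(1) finR finite_subset by blast
  then have injf: "inj_on f T" using T(3) by (simp add: eq_card_imp_inj_on)
  have muT: "(p w, v) \<in> \<mu> \<longleftrightarrow> v = f w" if "w \<in> T" for w v
    using f(1) that T(1) sv(1) by (metis single_valuedD subsetD)
  \<comment> \<open>The value \<open>f w\<close> is determined by \<open>p w\<close>, so injectivity
    of \<open>f\<close> passes to \<open>p\<close>.\<close>
  have injp: "inj_on p T"
    by (rule inj_onI) (metis injf inj_onD muT)
  have dom: "Domain B = p ` T" and ran: "Range B = T" by (auto simp: B_def)
  have "alternating \<mu> B"
    unfolding alternating_def
  proof (intro conjI)
    show "single_valued B" using injp by (auto simp: B_def single_valued_def inj_on_def)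
    show "single_valued (converse B)" by (auto simp: B_def single_valued_def)
    have "\<mu> `` (p ` T) = f ` T" using muT by blast
    then show 1: "\<mu> `` Domain B = Range B" using T(3) dom ran by simp
    show "converse \<mu> `` Range B = Domain B"
    proof
      show "converse \<mu> `` Range B \<subseteq> Domain B"
      proof
        fix m assume "m \<in> converse \<mu> `` Range B"
        then obtain v where v: "(m, v) \<in> \<mu>" "v \<in> f ` T" using T(3) ran by auto
        then obtain w where w: "w \<in> T" "v = f w" by blast
        then have "(p w, v) \<in> \<mu>" using muT by blast
        then have "m = p w" using v(1) sv(2) by (auto simp: single_valued_def)
        then show "m \<in> Domain B" using dom w by blast
      qed
      show "Domain B \<subseteq> converse \<mu> `` Range B"
      proof
        fix m assume "m \<in> Domain B"
        then obtain w where "w \<in> T" "m = p w" using dom by blast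
        then have "(m, f w) \<in> \<mu>" "f w \<in> T" using muT T(3) by blast+
        then show "m \<in> converse \<mu> `` Range B" using ran by blast
      qed
    qed
  qed
  moreover have "B \<subseteq> pointing E P Q \<mu>" using p(1) T(1) unfolding B_def by blast
  moreover have "B \<noteq> {}" using T(2) by (simp add: B_def)
  ultimately show ?thesis by blast
qed

section \<open>Deferred acceptance\<close>

text \<open>Men unmatched in \<mu> envy for every neighbour, so the condition also excludes that
  some stable matching matches them.\<close>

definition men_optimal :: "('m \<times> 'w) set \<Rightarrow> bool" where
  "men_optimal \<mu> \<longleftrightarrow> stable_matching E P Q \<mu> \<and> (\<forall>\<nu>. stable_matching E P Q \<nu> \<longrightarrow> \<nu> \<inter> envy E P \<mu> = {})"

text \<open>Each matching gives \<open>m\<close> a partner at least as good as the other does, so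
  the two partners coincide. Used in both directions, this is uniqueness.\<close>

lemma men_optimal_subset:
  assumes "men_optimal \<mu>" "men_optimal \<nu>"
  shows "\<nu> \<subseteq> \<mu>"
proof clarify
  fix m w assume mw: "(m, w) \<in> \<nu>"
  have st: "stable_matching E P Q \<mu>" "stable_matching E P Q \<nu>" using assms by (auto simp: men_optimal_def)
  have sub: "\<mu> \<subseteq> E" "\<nu> \<subseteq> E" and sv: "single_valued \<nu>"
    using st by (auto simp: stable_matching_def matching_def)
  have "(m, w) \<notin> envy E P \<mu>" using mw assms st by (auto simp: men_optimal_def)
  then obtain v where v: "(m, v) \<in> \<mu>" "(w, v) \<notin> P m" using mw sub by (auto simp: envy_def)
  have "(m, v) \<notin> envy E P \<nu>" using v assms st by (auto simp: men_optimal_def)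
  then obtain w' where "(m, w') \<in> \<nu>" "(v, w') \<notin> P m" using v sub by (auto simp: envy_def)
  then have "(v, w) \<notin> P m" using mw sv by (auto simp: single_valued_def)
  then have "v = w" using P_total[of m v w] v mw sub by blast
  then show "(m, w) \<in> \<mu>" using v by simp
qed

text \<open>Rotating along a nonempty \<open>B\<close> would produce a stable matching with an edge
  that a man desires. Conversely, a stable matching with such an edge yields a rotation.\<close>

lemma men_optimal_iff:
  "men_optimal \<mu> \<longleftrightarrow>
     stable_matching E P Q \<mu> \<and> (\<forall>B\<subseteq>pointing E P Q \<mu>. alternating \<mu> B \<longrightarrow> B = {})"
proof
  assume opt: "men_optimal \<mu>"
  then have st: "stable_matching E P Q \<mu>" by (simp add: men_optimal_def)
  have "B = {}" if "B \<subseteq> pointing E P Q \<mu>" "alternating \<mu> B" for B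
  proof -
    have "({(m, w) \<in> \<mu>. m \<notin> Domain B} \<union> B) \<inter> envy E P \<mu> = {}"
      using rotate_stable[OF st that(2,1)] opt by (simp add: men_optimal_def)
    then show ?thesis using that(1) pointing_subset by blast
  qed
  then show "stable_matching E P Q \<mu> \<and> (\<forall>B\<subseteq>pointing E P Q \<mu>. alternating \<mu> B \<longrightarrow> B = {})"
    using st by blast
next
  assume "stable_matching E P Q \<mu> \<and> (\<forall>B\<subseteq>pointing E P Q \<mu>. alternating \<mu> B \<longrightarrow> B = {})"
  then show "men_optimal \<mu>" using rotation_exists by (auto simp: men_optimal_def)
qed

text \<open>The best proposer \<open>b\<close> of a woman is not rejected and repeats his proposal
  in the next round, since further rejections only remove alternatives. So the proposals a woman
  holds never get worse.\<close>

lemma proposals_rejected: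
  assumes inv: "\<And>m w. (m, w) \<in> R \<Longrightarrow> \<exists>m'. (m', w) \<in> proposals E P R \<and> (m', m) \<in> Q w"
    and mw: "(m, w) \<in> R \<union> rejections E P Q R"
  shows "\<exists>m'. (m', w) \<in> proposals E P (R \<union> rejections E P Q R) \<and> (m', m) \<in> Q w"
proof -
  have sub: "proposals E P R \<subseteq> E" by (auto simp: proposals_def)
  obtain m' where m': "(m', w) \<in> proposals E P R" "(m', m) \<in> Q w"
    using mw inv by (auto simp: rejections_def)
  obtain b where b: "(b, w) \<in> proposals E P R"
    "\<And>m'. (m', w) \<in> proposals E P R \<Longrightarrow> m' \<noteq> b \<Longrightarrow> (b, m') \<in> Q w"
    using Q_best[OF sub m'(1)] by blast
  have "(b, w) \<notin> rejections E P Q R"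
    using b Q_asym Q_irrefl by (auto simp: rejections_def)
  then have "(b, w) \<in> proposals E P (R \<union> rejections E P Q R)"
    using b(1) by (auto simp: proposals_def)
  moreover have "(b, m) \<in> Q w" using b(2)[OF m'(1)] m'(2) Q_trans by blast
  ultimately show ?thesis by blast
qed

text \<open>If \<open>w\<close> rejects \<open>m\<close> in favour of \<open>m'\<close>, then
  \<open>m'\<close> has not been rejected by a partner in \<nu>, so he prefers \<open>w\<close> to
  any such partner and would block \<nu> together with her.\<close>

lemma stable_not_rejected:
  assumes st: "stable_matching E P Q \<nu>" and R: "\<nu> \<inter> R = {}"
  shows "\<nu> \<inter> rejections E P Q R = {}"
proof (rule ccontr)
  assume "\<not> ?thesis"
  then obtain m w m' where mw: "(m, w) \<in> \<nu>" and m': "(m', w) \<in> proposals E P R" "(m', m) \<in> Q w"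
    by (auto simp: rejections_def)
  have sv: "single_valued \<nu>" "single_valued (converse \<nu>)" "\<nu> \<subseteq> E"
    using st by (auto simp: stable_matching_def matching_def)
  have nm: "(m', w) \<notin> \<nu>" using mw m'(2) sv(2) Q_irrefl[of m w] unfolding single_valued_def by blast
  have "(w, v) \<in> P m'" if "(m', v) \<in> \<nu>" for v
  proof -
    have "v \<noteq> w" "(m', v) \<in> E - R" using that nm R sv by auto
    then show ?thesis using m'(1) by (auto simp: proposals_def)
  qed
  then have "(m', w) \<in> envy E P \<nu>" using m'(1) by (auto simp: envy_def proposals_def)
  then obtain h where "(h, w) \<in> \<nu>" "(h, m') \<in> Q w" using stableD[OF st] by blast
  then show False using mw m'(2) sv(2) Q_asym[of h m' w] unfolding single_valued_def by blast
qed

text \<open>Every man holds the best neighbour that has not rejected him, so all envied pairs lie in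
  \<open>R\<close>. They do not block, as the woman holds a better proposal, and they belong to no
  stable matching.\<close>

lemma proposals_final:
  assumes inv: "\<And>m w. (m, w) \<in> R \<Longrightarrow> \<exists>m'. (m', w) \<in> proposals E P R \<and> (m', m) \<in> Q w"
    and stR: "\<And>\<nu>. stable_matching E P Q \<nu> \<Longrightarrow> \<nu> \<inter> R = {}"
    and fin: "rejections E P Q R = {}"
  shows "men_optimal (proposals E P R)" (is "men_optimal ?\<mu>")
proof -
  have best: "\<exists>w0. (m, w0) \<in> ?\<mu> \<and> (w0 = w \<or> (w0, w) \<in> P m)" if "(m, w) \<in> E - R" for m w
    using P_best[of "E - R" m w] that by (auto simp: proposals_def)
  have mat: "matching E ?\<mu>"
    unfolding matching_def
  proof (intro conjI)
    show "?\<mu> \<subseteq> E" by (auto simp: proposals_def)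
    show "single_valued ?\<mu>"
      unfolding single_valued_def proposals_def using P_asym by blast
    show "single_valued (converse ?\<mu>)"
    proof (rule single_valuedI, rule ccontr)
      fix w m m' assume a: "(w, m) \<in> converse ?\<mu>" "(w, m') \<in> converse ?\<mu>" "m \<noteq> m'"
      then have "(m, m') \<in> Q w \<or> (m', m) \<in> Q w"
        using Q_total[of m w m'] by (auto simp: proposals_def)
      then show False using a(1,2) fin by (auto simp: rejections_def)
    qed
  qed
  have opt: "(m, w) \<notin> envy E P ?\<mu>" if "(m, w) \<in> E - R" for m w
  proof
    assume "(m, w) \<in> envy E P ?\<mu>"
    then show False using best[OF that] P_irrefl P_asym by (auto simp: envy_def)
  qed
  have "blocking E P Q ?\<mu> = {}"
  proof (rule ccontr)
    assume "blocking E P Q ?\<mu> \<noteq> {}"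
    then obtain m w where mw: "(m, w) \<in> envy E P ?\<mu>" "\<And>m'. (m', w) \<in> ?\<mu> \<Longrightarrow> (m, m') \<in> Q w"
      by (auto simp: blocking_def envy_def)
    then have "(m, w) \<in> R" using opt envy_subset by blast
    then show False using inv mw(2) Q_asym by blast
  qed
  then have "stable_matching E P Q ?\<mu>" using mat by (simp add: stable_matching_def)
  moreover have "\<nu> \<inter> envy E P ?\<mu> = {}" if "stable_matching E P Q \<nu>" for \<nu>
  proof (rule ccontr)
    assume "\<not> ?thesis"
    then obtain m w where "(m, w) \<in> \<nu>" "(m, w) \<in> envy E P ?\<mu>" by auto
    moreover from this have "(m, w) \<in> E - R" using stR[OF that] envy_subset by blast
    ultimately show False using opt by simp
  qed
  ultimately show ?thesis by (simp add: men_optimal_def)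
qed

lemma men_optimal_mpda: "men_optimal (mpda E P Q)"
proof -
  \<comment> \<open>The loop invariant: a woman who has rejected somebody holds a better proposal,
    and no edge of a stable matching has been rejected. Every further round lowers the number of
    edges not yet rejected.\<close>
  define I where "I R \<longleftrightarrow> R \<subseteq> E \<and>
    (\<forall>m w. (m, w) \<in> R \<longrightarrow> (\<exists>m'. (m', w) \<in> proposals E P R \<and> (m', m) \<in> Q w)) \<and>
    (\<forall>\<nu>. stable_matching E P Q \<nu> \<longrightarrow> \<nu> \<inter> R = {})" for R
  have rej: "rejections E P Q R \<subseteq> E - R" for R
    by (auto simp: rejections_def proposals_def)
  show ?thesis
    unfolding mpda_def
  proof (rule while_rule2[where P = I and r = "Wellfounded.measure (\<lambda>R. card (E - R))"])
    show "I {}" by (simp add: I_def)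
    fix R assume IR: "I R"
    let ?R = "R \<union> rejections E P Q R"
    {
      assume ne: "rejections E P Q R \<noteq> {}"
      have "I ?R"
        unfolding I_def
      proof (intro conjI allI impI)
        show "?R \<subseteq> E" using IR rej by (auto simp: I_def)
        show "\<exists>m'. (m', w) \<in> proposals E P ?R \<and> (m', m) \<in> Q w" if "(m, w) \<in> ?R" for m w
          by (rule proposals_rejected[OF _ that]) (use IR in \<open>auto simp: I_def\<close>)
        show "\<nu> \<inter> ?R = {}" if "stable_matching E P Q \<nu>" for \<nu>
          using stable_not_rejected[OF that] IR that by (simp add: I_def Int_Un_distrib)
      qed
      moreover have "card (E - ?R) < card (E - R)"
        by (rule psubset_card_mono) (use fin ne rej in auto)
      ultimately show "I ?R \<and> (?R, R) \<in> Wellfounded.measure (\<lambda>R. card (E - R))" by simp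
    }
    show "men_optimal (proposals E P R)" if "\<not> rejections E P Q R \<noteq> {}"
      by (rule proposals_final) (use IR that in \<open>auto simp: I_def\<close>)
  qed simp
qed

lemma mpda_eq_iff:
  "mpda E P Q = \<mu> \<longleftrightarrow>
     stable_matching E P Q \<mu> \<and> (\<forall>B\<subseteq>pointing E P Q \<mu>. alternating \<mu> B \<longrightarrow> B = {})"
  using men_optimal_mpda men_optimal_subset men_optimal_iff by (metis subset_antisym)

end

section \<open>The cycles of the pointer graph\<close>

text \<open>For a matching in a market this union is itself alternating, hence the largest
  alternating set of pointers. It stands for all cycles at once without following walks.\<close>

definition cycles ::
  "('m \<times> 'w) set \<Rightarrow> ('m \<Rightarrow> 'w rel) \<Rightarrow> ('w \<Rightarrow> 'm rel) \<Rightarrow> ('m \<times> 'w) set \<Rightarrow> ('m \<times> 'w) set" where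
  "cycles E P Q \<mu> = \<Union> {B. B \<subseteq> pointing E P Q \<mu> \<and> alternating \<mu> B}"

text \<open>Men's uniqueness in the union is a counting argument: \<open>\<mu>\<close> maps the men onto the women, and each
  woman has only one edge.\<close>

lemma alternating_Union:
  assumes F: "finite F" "single_valued (converse F)" and mu: "single_valued \<mu>"
    and alt: "\<And>B. B \<in> \<B> \<Longrightarrow> B \<subseteq> F \<and> alternating \<mu> B"
  shows "alternating \<mu> (\<Union> \<B>)"
proof -
  let ?U = "\<Union> \<B>"
  have UF: "?U \<subseteq> F" using alt by blast
  then have finU: "finite ?U" using F(1) finite_subset by blast
  have svU: "single_valued (converse ?U)"
    using UF F(2) by (meson converse_mono single_valued_subset)
  have D: "Domain ?U = (\<Union>B\<in>\<B>. Domain B)" and R: "Range ?U = (\<Union>B\<in>\<B>. Range B)" by auto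
  have 1: "\<mu> `` Domain ?U = Range ?U"
    unfolding D R using alt by (simp add: Image_UN alternating_def)
  have 2: "converse \<mu> `` Range ?U = Domain ?U"
    unfolding D R using alt by (simp add: Image_UN alternating_def)
  have "inj_on snd ?U" using svU by (fastforce simp: inj_on_def single_valued_def)
  then have "card ?U = card (Range ?U)" by (simp add: card_image Range_snd)
  also have "\<dots> \<le> card (Domain ?U)"
  proof (rule surj_card_le)
    show "Range ?U \<subseteq> (\<lambda>m. THE w. (m, w) \<in> \<mu>) ` Domain ?U"
    proof
      fix w assume "w \<in> Range ?U"
      then obtain m where m: "m \<in> Domain ?U" "(m, w) \<in> \<mu>" using 1 by blast
      then have "(THE w. (m, w) \<in> \<mu>) = w"
        using mu by (auto simp: single_valued_def intro!: the_equality)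
      then show "w \<in> (\<lambda>m. THE w. (m, w) \<in> \<mu>) ` Domain ?U" using m(1) by force
    qed
  qed (use finU in \<open>simp add: finite_Domain\<close>)
  also have "\<dots> = card (fst ` ?U)" by (simp add: Domain_fst)
  finally have "inj_on fst ?U"
    using finU by (simp add: card_image_le eq_card_imp_inj_on le_antisym)
  then have "single_valued ?U" by (force simp: inj_on_def single_valued_def)
  then show ?thesis using svU 1 2 by (simp add: alternating_def)
qed

context market
begin

lemma alternating_cycles: "matching E \<mu> \<Longrightarrow> alternating \<mu> (cycles E P Q \<mu>)"
  unfolding cycles_def
proof (rule alternating_Union)
  show "finite (pointing E P Q \<mu>)"
    using fin pointing_subset envy_subset finite_subset by metis
qed (use single_valued_pointing in \<open>auto simp: matching_def\<close>)

lemma cycles_subset: "cycles E P Q \<mu> \<subseteq> E"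
  unfolding cycles_def using pointing_subset envy_subset by blast

text \<open>Links the upward counts needed for the inversion to the pointer condition on which the
  exchange acts.\<close>

lemma subset_cycles_iff: "alternating \<mu> B \<Longrightarrow> B \<subseteq> cycles E P Q \<mu> \<longleftrightarrow> B \<subseteq> pointing E P Q \<mu>"
  unfolding cycles_def by blast

lemma mpda_eq_iff_cycles: "mpda E P Q = \<mu> \<longleftrightarrow> stable_matching E P Q \<mu> \<and> cycles E P Q \<mu> = {}"
  unfolding mpda_eq_iff cycles_def by blast

end

section \<open>Exchanging pointers and blocking pairs\<close>

text \<open>Pulling the ranking back along a transposition exchanges the positions of the
  \<open>B\<close>-partner and the \<mu>-partner. Both \<open>THE\<close> terms are well defined
  when \<mu> is a matching and \<open>B\<close> is alternating.\<close>

definition swap_partners ::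
  "('m \<times> 'w) set \<Rightarrow> ('m \<times> 'w) set \<Rightarrow> ('w \<Rightarrow> 'm rel) \<Rightarrow> 'w \<Rightarrow> 'm rel" where
  "swap_partners \<mu> B Q w =
     (if w \<in> Range B
      then inv_image (Q w) (Transposition.transpose (THE m. (m, w) \<in> B) (THE m. (m, w) \<in> \<mu>))
      else Q w)"

text \<open>The transposition at \<open>w\<close> does not depend on \<open>Q\<close>, and it is its
  own inverse.\<close>

lemma swap_partners_swap_partners [simp]: "swap_partners \<mu> B (swap_partners \<mu> B Q) = Q"
  by (auto simp: swap_partners_def fun_eq_iff inv_image_def)

context
  fixes E \<mu> B :: "('m \<times> 'w) set"
  assumes mat: "matching E \<mu>" and alt: "alternating \<mu> B"
begin

lemma alternating_partners:
  assumes "w \<in> Range B"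
  obtains b h where "(b, w) \<in> B" "(h, w) \<in> \<mu>" "(h, w) \<in> E"
    "\<And>m. (m, w) \<in> B \<longleftrightarrow> m = b" "\<And>m. (m, w) \<in> \<mu> \<longleftrightarrow> m = h"
    "\<And>Q. swap_partners \<mu> B Q w = inv_image (Q w) (Transposition.transpose b h)"
proof -
  have sv: "single_valued (converse \<mu>)" "single_valued (converse B)" "\<mu> \<subseteq> E"
    "\<mu> `` Domain B = Range B"
    using mat alt by (auto simp: matching_def alternating_def)
  obtain b where b: "(b, w) \<in> B" using assms by blast
  obtain h where h: "(h, w) \<in> \<mu>" using assms sv(4) by blast
  have b': "(m, w) \<in> B \<longleftrightarrow> m = b" for m using b sv(2) by (auto simp: single_valued_def)
  have h': "(m, w) \<in> \<mu> \<longleftrightarrow> m = h" for m using h sv(1) by (auto simp: single_valued_def)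
  show thesis
    by (rule that[of b h]) (use b h sv(3) b' h' assms in \<open>auto simp: swap_partners_def\<close>)
qed

lemma swap_partners_pref_orders:
  assumes "B \<subseteq> E" "\<forall>w. Q w \<in> pref_orders (converse E `` {w})"
  shows "swap_partners \<mu> B Q w \<in> pref_orders (converse E `` {w})"
proof (cases "w \<in> Range B")
  case True
  then obtain b h where bh: "(b, w) \<in> B" "(h, w) \<in> E"
    "swap_partners \<mu> B Q w = inv_image (Q w) (Transposition.transpose b h)"
    by (rule alternating_partners) auto
  show ?thesis
    unfolding bh(3)
  proof (rule pref_orders_inv_image)
    show "Transposition.transpose b h a \<in> converse E `` {w}" if "a \<in> converse E `` {w}" for a
      using that bh(1,2) assms(1) by (auto simp: Transposition.transpose_def)
  qed (use assms in auto)
next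
  case False
  then show ?thesis using assms by (simp add: swap_partners_def)
qed

text \<open>Envy of men is unaffected by the exchange, so each woman can be treated separately. On
  the left a woman in \<open>B\<close> ranks her \<mu>-partner \<open>h\<close> first, then
  \<open>b\<close>, then the other men desiring her. After the exchange \<open>b\<close> is above
  \<open>h\<close> and \<open>h\<close> above the others, so \<open>b\<close> alone blocks with
  her.\<close>

lemma blocking_swap_partners:
  assumes mk: "market E P Q"
  shows "stable_matching E P Q \<mu> \<and> B \<subseteq> pointing E P Q \<mu> \<longleftrightarrow>
    blocking E P (swap_partners \<mu> B Q) \<mu> = B"
proof -
  interpret market E P Q by (rule mk)
  let ?A = "envy E P \<mu>" and ?Q = "swap_partners \<mu> B Q"
  have blk: "(m, w) \<in> blocking E P R \<mu> \<longleftrightarrow>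
      (m, w) \<in> ?A \<and> (\<forall>m'. (m', w) \<in> \<mu> \<longrightarrow> (m, m') \<in> R w)" for m w and R :: "'w \<Rightarrow> 'm rel"
    by (auto simp: blocking_def envy_def)
  have column: "(\<forall>m. (m, w) \<notin> blocking E P Q \<mu>) \<and> (\<forall>m. (m, w) \<in> B \<longrightarrow> (m, w) \<in> pointing E P Q \<mu>)
      \<longleftrightarrow> (\<forall>m. (m, w) \<in> blocking E P ?Q \<mu> \<longleftrightarrow> (m, w) \<in> B)" if BA: "B \<subseteq> ?A" for w
  proof (cases "w \<in> Range B")
    case True
    then obtain b h where bh: "(b, w) \<in> B" "(h, w) \<in> \<mu>" "(h, w) \<in> E"
      "\<And>m. (m, w) \<in> B \<longleftrightarrow> m = b" "\<And>m. (m, w) \<in> \<mu> \<longleftrightarrow> m = h"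
      "?Q w = inv_image (Q w) (Transposition.transpose b h)"
      by (rule alternating_partners) blast
    have bA: "(b, w) \<in> ?A" using BA bh(1) by blast
    have hA: "(h, w) \<notin> ?A" using bh(2) P_irrefl by (auto simp: envy_def)
    have lhs: "(\<forall>m. (m, w) \<notin> blocking E P Q \<mu>) \<and> (\<forall>m. (m, w) \<in> B \<longrightarrow> (m, w) \<in> pointing E P Q \<mu>)
      \<longleftrightarrow> (\<forall>m. (m, w) \<in> ?A \<longrightarrow> (m, h) \<notin> Q w) \<and> (\<forall>m. (m, w) \<in> ?A \<and> m \<noteq> b \<longrightarrow> (b, m) \<in> Q w)"
      using bA by (auto simp: blk bh(4,5) pointing_def)
    \<comment> \<open>After the exchange \<open>h\<close> sits in the old place of \<open>b\<close>,
      and \<open>b\<close> in that of \<open>h\<close>. Any other man desiring \<open>w\<close>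
      keeps his place, as \<open>h\<close> does not desire her.\<close>
    have swap: "(m, h) \<in> ?Q w \<longleftrightarrow> (if m = b then (h, b) \<in> Q w else (m, b) \<in> Q w)"
      if "(m, w) \<in> ?A" for m
      using that hA by (auto simp: bh(6) Transposition.transpose_def)
    have rhs: "(\<forall>m. (m, w) \<in> blocking E P ?Q \<mu> \<longleftrightarrow> (m, w) \<in> B) \<longleftrightarrow>
      (h, b) \<in> Q w \<and> (\<forall>m. (m, w) \<in> ?A \<and> m \<noteq> b \<longrightarrow> (m, b) \<notin> Q w)"
      unfolding blk bh(4,5) using bA swap by (simp; metis)
    have tot: "(m, m') \<notin> Q w \<longleftrightarrow> (m', m) \<in> Q w" if "(m, w) \<in> E" "(m', w) \<in> E" "m \<noteq> m'" for m m'
      using Q_total[OF that] Q_asym by blast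
    have 1: "(m, h) \<notin> Q w \<longleftrightarrow> (h, m) \<in> Q w" if "(m, w) \<in> ?A" for m
      using tot[of m h] that hA bh(3) envy_subset by blast
    have 2: "(m, b) \<notin> Q w \<longleftrightarrow> (b, m) \<in> Q w" if "(m, w) \<in> ?A" "m \<noteq> b" for m
      using tot[of m b] that bA envy_subset by blast
    have 3: "(h, m) \<in> Q w" if "(h, b) \<in> Q w" "(b, m) \<in> Q w" for m using Q_trans that by blast
    show ?thesis unfolding lhs rhs using 1 2 3 bA by metis
  next
    case False
    then have "(m, w) \<notin> B" for m by blast
    moreover have "?Q w = Q w" using False by (simp add: swap_partners_def)
    ultimately show ?thesis by (simp add: blk)
  qed
  have lhs: "stable_matching E P Q \<mu> \<and> B \<subseteq> pointing E P Q \<mu> \<longleftrightarrow>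
    (\<forall>w. (\<forall>m. (m, w) \<notin> blocking E P Q \<mu>) \<and> (\<forall>m. (m, w) \<in> B \<longrightarrow> (m, w) \<in> pointing E P Q \<mu>))"
    using mat by (auto simp: stable_matching_def)
  have rhs: "blocking E P ?Q \<mu> = B \<longleftrightarrow> (\<forall>w m. (m, w) \<in> blocking E P ?Q \<mu> \<longleftrightarrow> (m, w) \<in> B)"
    by auto
  show ?thesis
  \<comment> \<open>Pointers and blocking pairs are both envied pairs, so both sides fail if
    \<open>B\<close> is not contained in \<open>?A\<close>.\<close>
  proof (cases "B \<subseteq> ?A")
    case True
    then show ?thesis unfolding lhs rhs by (simp only: column[OF True])
  next
    case False
    then have "\<not> B \<subseteq> pointing E P Q \<mu>" using pointing_subset by blast
    moreover have "blocking E P ?Q \<mu> \<noteq> B" using False by (auto simp: blocking_def)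
    ultimately show ?thesis by blast
  qed
qed

end

text \<open>Elements of the types that are not agents have no neighbours and hence only the empty
  order, so these total functions correspond to profiles of the agents.\<close>

definition profiles :: "('m \<times> 'w) set \<Rightarrow> (('m \<Rightarrow> 'w rel) \<times> ('w \<Rightarrow> 'm rel)) set" where
  "profiles E = {P. \<forall>m. P m \<in> pref_orders (E `` {m})} \<times>
     {Q. \<forall>w. Q w \<in> pref_orders (converse E `` {w})}"

lemma market_iff: "market E P Q \<longleftrightarrow> finite E \<and> (P, Q) \<in> profiles E"
  by (auto simp: market_def profiles_def)

lemma card_profiles_converse:
  "card {p \<in> profiles (converse E). case p of (Q, P) \<Rightarrow> R P Q} =
   card {p \<in> profiles E. case p of (P, Q) \<Rightarrow> R P Q}"
proof -
  have "{p \<in> profiles (converse E). case p of (Q, P) \<Rightarrow> R P Q} =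
      prod.swap ` {p \<in> profiles E. case p of (P, Q) \<Rightarrow> R P Q}"
    by (auto simp: profiles_def image_iff)
  then show ?thesis by (simp add: card_image)
qed

text \<open>The exchange is an involution on profiles that carries one event to the other. The event
  on the right treats men and women alike.\<close>

lemma card_subset_cycles:
  assumes fin: "finite E" and mat: "matching E \<mu>" and alt: "alternating \<mu> B"
  shows "card {p \<in> profiles E. case p of (P, Q) \<Rightarrow> stable_matching E P Q \<mu> \<and> B \<subseteq> cycles E P Q \<mu>} =
    card {p \<in> profiles E. case p of (P, Q) \<Rightarrow> blocking E P Q \<mu> = B}" (is "card ?X = card ?Y")
proof -
  have mk: "market E P Q" if "(P, Q) \<in> profiles E" for P Q using that fin market_iff by blast
  have X: "?X = {p \<in> profiles E.
      case p of (P, Q) \<Rightarrow> blocking E P (swap_partners \<mu> B Q) \<mu> = B}"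
    using market.subset_cycles_iff[OF mk alt] blocking_swap_partners[OF mat alt mk]
    by (intro Collect_cong) (simp split: prod.split cong: conj_cong)
  show ?thesis
  proof (cases "B \<subseteq> E")
    case True
    let ?f = "\<lambda>(P, Q). (P, swap_partners \<mu> B Q)"
    have prof: "(P, swap_partners \<mu> B Q) \<in> profiles E" if "(P, Q) \<in> profiles E" for P Q
      using that swap_partners_pref_orders[OF mat alt True] by (auto simp: profiles_def)
    have "bij_betw ?f ?X ?Y"
      unfolding X by (rule bij_betw_byWitness[where f' = ?f]) (use prof in auto)
    then show ?thesis by (rule bij_betw_same_card)
  next
    \<comment> \<open>The exchange may leave the set of profiles here, but both events are
      empty.\<close>
    case False
    have "blocking E P Q \<mu> \<subseteq> E" for P Q by (auto simp: blocking_def envy_def)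
    then have "?X = {}" "?Y = {}" unfolding X using False by blast+
    then show ?thesis by (simp only: card.empty)
  qed
qed

section \<open>Equality of the distributions\<close>

text \<open>Moebius inversion by induction on the number of strict supersets of \<open>B\<close> in
  \<open>\<A>\<close>: subtracting the counts for these supersets, equal by induction, from the
  upward counts leaves the counts for \<open>B\<close>.\<close>

lemma card_eq_if_upward_card_eq:
  fixes f g :: "'p \<Rightarrow> 'a set"
  assumes "finite X" "finite Y" "finite \<A>"
    and f: "\<And>p. p \<in> X \<Longrightarrow> f p \<in> \<A>" and g: "\<And>p. p \<in> Y \<Longrightarrow> g p \<in> \<A>"
    and eq: "\<And>B. B \<in> \<A> \<Longrightarrow> card {p \<in> X. B \<subseteq> f p} = card {p \<in> Y. B \<subseteq> g p}"
    and "B \<in> \<A>"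
  shows "card {p \<in> X. f p = B} = card {p \<in> Y. g p = B}"
  using \<open>B \<in> \<A>\<close>
proof (induction "card {C \<in> \<A>. B \<subset> C}" arbitrary: B rule: less_induct)
  case less
  let ?S = "{C \<in> \<A>. B \<subset> C}"
  have split: "card {p \<in> Z. B \<subseteq> h p} = card {p \<in> Z. h p = B} + (\<Sum>C\<in>?S. card {p \<in> Z. h p = C})"
    if "finite Z" and h: "\<And>p. p \<in> Z \<Longrightarrow> h p \<in> \<A>" for Z and h :: "'p \<Rightarrow> 'a set"
  proof -
    have "{p \<in> Z. B \<subseteq> h p} = {p \<in> Z. h p = B} \<union> (\<Union>C\<in>?S. {p \<in> Z. h p = C})"
      using h by auto
    also have "card \<dots> = card {p \<in> Z. h p = B} + card (\<Union>C\<in>?S. {p \<in> Z. h p = C})"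
      using that(1) by (intro card_Un_disjoint) (auto intro: finite_subset[of _ Z])
    also have "card (\<Union>C\<in>?S. {p \<in> Z. h p = C}) = (\<Sum>C\<in>?S. card {p \<in> Z. h p = C})"
      using that(1) \<open>finite \<A>\<close> by (intro card_UN_disjoint) auto
    finally show ?thesis .
  qed
  have "card {p \<in> X. f p = C} = card {p \<in> Y. g p = C}" if C: "C \<in> ?S" for C
  proof (rule less.hyps)
    show "card {D \<in> \<A>. C \<subset> D} < card ?S"
      using C \<open>finite \<A>\<close> by (intro psubset_card_mono) auto
  qed (use C in simp)
  then show ?case
    using eq[OF less.prems] split[OF \<open>finite X\<close> f] split[OF \<open>finite Y\<close> g] by simp
qed

lemma PiE_dflt_eq_Collect:
  assumes "\<And>x. x \<notin> A \<Longrightarrow> B x = {d}"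
  shows "PiE_dflt A d B = {f. \<forall>x. f x \<in> B x}"
proof -
  have "f x \<in> B x \<longleftrightarrow> f x = d" if "x \<notin> A" for f x using assms[OF that] by simp
  then show ?thesis unfolding PiE_dflt_def by blast
qed

text \<open>A product of uniform distributions is uniform on the product set, which turns
  probabilities into counts.\<close>

lemma random_profile_eq_pmf_of_set:
  assumes "finite M" "finite W" "E \<subseteq> M \<times> W"
  shows "finite (profiles E)" "profiles E \<noteq> {}"
    and "random_profile M W E = pmf_of_set (profiles E)"
proof -
  have finE: "finite E" using assms by (auto intro: finite_subset)
  then have finI: "finite (E `` {m})" "finite (converse E `` {w})" for m w by auto
  \<comment> \<open>The sole order on the empty set is the default value \<open>{}\<close> of
    \<open>Pi_pmf\<close>, so the two descriptions agree at non-agents.\<close>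
  have empty: "pref_orders {} = {{} :: 'z rel}"
    using pref_orders_nonempty[of "{} :: 'z set"] by (auto simp: pref_orders_def)
  have "E `` {m} = {}" if "m \<notin> M" for m using that assms(3) by auto
  then have outM: "pref_orders (E `` {m}) = {{}}" if "m \<notin> M" for m using that empty by simp
  have "converse E `` {w} = {}" if "w \<notin> W" for w using that assms(3) by auto
  then have outW: "pref_orders (converse E `` {w}) = {{}}" if "w \<notin> W" for w
    using that empty by simp
  let ?PM = "PiE_dflt M {} (\<lambda>m. pref_orders (E `` {m}))"
    and ?PW = "PiE_dflt W {} (\<lambda>w. pref_orders (converse E `` {w}))"
  have PM: "?PM = {P. \<forall>m. P m \<in> pref_orders (E `` {m})}"
    using outM by (rule PiE_dflt_eq_Collect)
  have PW: "?PW = {Q. \<forall>w. Q w \<in> pref_orders (converse E `` {w})}"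
    using outW by (rule PiE_dflt_eq_Collect)
  have prof: "profiles E = ?PM \<times> ?PW" unfolding profiles_def PM PW ..
  have fin: "finite ?PM" "finite ?PW"
    by (intro finite_PiE_dflt assms finite_pref_orders finI)+
  have "(\<lambda>m. SOME r. r \<in> pref_orders (E `` {m})) \<in> ?PM"
    unfolding PM using pref_orders_nonempty[OF finI(1)] some_in_eq by blast
  moreover have "(\<lambda>w. SOME r. r \<in> pref_orders (converse E `` {w})) \<in> ?PW"
    unfolding PW using pref_orders_nonempty[OF finI(2)] some_in_eq by blast
  ultimately have ne: "?PM \<noteq> {}" "?PW \<noteq> {}" by blast+
  show "finite (profiles E)" "profiles E \<noteq> {}" unfolding prof using fin ne by auto
  have "random_profile M W E = pair_pmf (pmf_of_set ?PM) (pmf_of_set ?PW)"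
    unfolding random_profile_def
    by (intro arg_cong2[where f = pair_pmf] Pi_pmf_of_set assms finite_pref_orders
        pref_orders_nonempty finI)
  also have "\<dots> = pmf_of_set (?PM \<times> ?PW)"
    using fin ne
    by (intro pmf_eqI) (auto simp: pmf_pair indicator_def card_cartesian_product)
  finally show "random_profile M W E = pmf_of_set (profiles E)" by (simp only: prof)
qed

lemma card_mpda_eq_card_wpda:
  assumes finE: "finite E" and finP: "finite (profiles E)"
  shows "card {p \<in> profiles E. case p of (P, Q) \<Rightarrow> mpda E P Q = \<mu>} =
    card {p \<in> profiles E. case p of (P, Q) \<Rightarrow> wpda E P Q = \<mu>}"
proof -
  have mk: "market E P Q" "market (converse E) Q P" if "(P, Q) \<in> profiles E" for P Q
    using that finE by (auto simp: market_iff profiles_def)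
  define X where "X = {p \<in> profiles E. case p of (P, Q) \<Rightarrow> stable_matching E P Q \<mu>}"
  define f where "f = (\<lambda>(P, Q). cycles E P Q \<mu>)"
  \<comment> \<open>These are the cycles of the men's pointers, turned back into edges of
    \<open>E\<close> so that \<open>f\<close> and \<open>g\<close> take values in the same
    family.\<close>
  define g where "g = (\<lambda>(P, Q). converse (cycles (converse E) Q P (converse \<mu>)))"
  have "mpda E P Q = \<mu> \<longleftrightarrow> (P, Q) \<in> X \<and> f (P, Q) = {}" if "(P, Q) \<in> profiles E" for P Q
    using market.mpda_eq_iff_cycles[OF mk(1)[OF that]] that by (simp add: X_def f_def)
  then have mpda: "{p \<in> profiles E. case p of (P, Q) \<Rightarrow> mpda E P Q = \<mu>} = {p \<in> X. f p = {}}"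
    by (auto simp: X_def)
  have "wpda E P Q = \<mu> \<longleftrightarrow> (P, Q) \<in> X \<and> g (P, Q) = {}" if "(P, Q) \<in> profiles E" for P Q
  proof -
    have "wpda E P Q = \<mu> \<longleftrightarrow> mpda (converse E) Q P = converse \<mu>"
      unfolding wpda_def by auto
    then show ?thesis
      using market.mpda_eq_iff_cycles[OF mk(2)[OF that]] that
      by (auto simp: X_def g_def stable_converse)
  qed
  then have wpda: "{p \<in> profiles E. case p of (P, Q) \<Rightarrow> wpda E P Q = \<mu>} = {p \<in> X. g p = {}}"
    by (auto simp: X_def)
  show ?thesis
  proof (cases "matching E \<mu>")
    case False
    then have "X = {}" by (auto simp: X_def stable_matching_def)
    then show ?thesis unfolding mpda wpda by simp
  next
    case mat: True
    then have mat': "matching (converse E) (converse \<mu>)" by (simp add: matching_converse)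
    let ?A = "{B. B \<subseteq> E \<and> alternating \<mu> B}"
    have "card {p \<in> X. f p = {}} = card {p \<in> X. g p = {}}"
    proof (rule card_eq_if_upward_card_eq[where \<A> = ?A])
      show "finite X" "finite X" using finP by (auto simp: X_def)
      show "finite ?A" using finE by simp
      show "{} \<in> ?A" by (simp add: alternating_empty)
      show "f p \<in> ?A" if pX: "p \<in> X" for p
      proof -
        obtain P Q where p: "p = (P, Q)" "(P, Q) \<in> profiles E" using pX by (auto simp: X_def)
        show ?thesis
          using market.alternating_cycles[OF mk(1)[OF p(2)] mat] market.cycles_subset[OF mk(1)[OF p(2)]]
          by (simp add: f_def p(1))
      qed
      show "g p \<in> ?A" if pX: "p \<in> X" for p
      proof -
        obtain P Q where p: "p = (P, Q)" "(P, Q) \<in> profiles E" using pX by (auto simp: X_def)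
        have "alternating (converse \<mu>) (converse (g p))"
          using market.alternating_cycles[OF mk(2)[OF p(2)] mat'] by (simp add: g_def p)
        moreover have "converse (g p) \<subseteq> converse E"
          using market.cycles_subset[OF mk(2)[OF p(2)]] by (simp add: g_def p)
        ultimately show ?thesis by (simp add: alternating_converse)
      qed
      fix B assume "B \<in> ?A"
      then have alt: "alternating \<mu> B" by simp
      then have alt': "alternating (converse \<mu>) (converse B)" by (simp add: alternating_converse)
      have "card {p \<in> X. B \<subseteq> f p} = card {p \<in> profiles E. case p of (P, Q) \<Rightarrow>
          stable_matching E P Q \<mu> \<and> B \<subseteq> cycles E P Q \<mu>}"
        by (rule arg_cong[where f = card]) (auto simp: X_def f_def)
      also have "\<dots> = card {p \<in> profiles E. case p of (P, Q) \<Rightarrow> blocking E P Q \<mu> = B}"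
        by (rule card_subset_cycles[OF finE mat alt])
      \<comment> \<open>Blocking pairs are symmetric in the two sides, so the exchange can be
        applied again with men and women interchanged.\<close>
      also have "\<dots> = card {p \<in> profiles (converse E). case p of (Q, P) \<Rightarrow>
          blocking (converse E) Q P (converse \<mu>) = converse B}"
        by (simp add: card_profiles_converse blocking_converse)
      also have "\<dots> = card {p \<in> profiles (converse E). case p of (Q, P) \<Rightarrow>
          stable_matching (converse E) Q P (converse \<mu>) \<and>
          converse B \<subseteq> cycles (converse E) Q P (converse \<mu>)}"
        by (rule card_subset_cycles[symmetric]) (use finE mat' alt' in auto)
      also have "\<dots> = card {p \<in> profiles E. case p of (P, Q) \<Rightarrow>
          stable_matching (converse E) Q P (converse \<mu>) \<and>
          converse B \<subseteq> cycles (converse E) Q P (converse \<mu>)}"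
        by (rule card_profiles_converse)
      also have "\<dots> = card {p \<in> X. B \<subseteq> g p}"
        by (rule arg_cong[where f = card]) (auto simp: X_def g_def stable_converse)
      finally show "card {p \<in> X. B \<subseteq> f p} = card {p \<in> X. B \<subseteq> g p}" .
    qed
    then show ?thesis unfolding mpda wpda .
  qed
qed

theorem theorem1:
  fixes M :: "'m set" and W :: "'w set" and E :: "('m \<times> 'w) set"
  assumes "finite M" and "finite W" and "E \<subseteq> M \<times> W"
  shows "map_pmf (\<lambda>(P, Q). mpda E P Q) (random_profile M W E) =
           map_pmf (\<lambda>(P, Q). wpda E P Q) (random_profile M W E) \<and>
         (\<forall>\<mu>. matching E \<mu> \<longrightarrow>
           measure_pmf.prob (random_profile M W E) {(P, Q). mpda E P Q = \<mu>} =
           measure_pmf.prob (random_profile M W E) {(P, Q). wpda E P Q = \<mu>})"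
proof -
  note prof = random_profile_eq_pmf_of_set[OF assms]
  have finE: "finite E" using assms by (auto intro: finite_subset)
  have Int: "profiles E \<inter> {(P, Q). R P Q} = {p \<in> profiles E. case p of (P, Q) \<Rightarrow> R P Q}"
    for R :: "('m \<Rightarrow> 'w rel) \<Rightarrow> ('w \<Rightarrow> 'm rel) \<Rightarrow> bool"
    by auto
  \<comment> \<open>The counts agree for every \<mu>, whether a matching or not, so the point
    probabilities already determine equality of the distributions.\<close>
  have eq: "measure_pmf.prob (random_profile M W E) {(P, Q). mpda E P Q = \<mu>} =
      measure_pmf.prob (random_profile M W E) {(P, Q). wpda E P Q = \<mu>}" for \<mu>
    unfolding prof(3) measure_pmf_of_set[OF prof(2,1)] Int
      card_mpda_eq_card_wpda[OF finE prof(1)] ..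
  have vimage: "(\<lambda>(P, Q). F P Q) -` {\<mu>} = {(P, Q). F P Q = \<mu>}"
    for F :: "('m \<Rightarrow> 'w rel) \<Rightarrow> ('w \<Rightarrow> 'm rel) \<Rightarrow> ('m \<times> 'w) set" and \<mu>
    by auto
  show ?thesis
    using eq by (intro conjI pmf_eqI) (simp_all add: pmf_map vimage)
qed

end
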